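(* Let $X,Y$ be nonempty sets and $E,K$ sets of parameters. Let $(X,\tau)$ be a fuzzy soft topological space with parameter set $E$ and $(Y,\sigma)$ a fuzzy soft topological space with parameter set $K$. Let $(\varphi,\psi):(X,\tau)\to(Y,\sigma)$, with $\varphi:X\to Y$ and $\psi:E\to K$, be a fuzzy soft mapping that is fuzzy soft continuous and surjective. If $(X,\tau)$ is compact, then $(Y,\sigma)$ is compact.
   Context: Let $I=[0,1]$ and let $I^X$ be the set of all fuzzy sets on $X$, i.e. functions $X\to[0,1]$, ordered pointwise; $0_X$ and $1_X$ are the constant functions $0$ and $1$. A fuzzy soft set over $X$ with parameter set $E$ is a mapping $(f,A):E\to I^X$, where $A\subseteq E$ is the set of parameters $e$ with $(f,A)(e)\neq 0_X$ (so $(f,A)(e)=0_X$ for $e\notin A$); thus $A$ is determined by the mapping. $FS(X,E)$ is the family of all fuzzy soft sets over $X$. Inclusion $(f,A)\subseteq(g,B)$ means $(f,A)(e)\le (g,B)(e)$ for every $e\in E$. Unions and intersections are taken pointwise: for each $e\in E$ and $x\in X$, the supremum, respectively infimum, of the values. The null fuzzy soft set $\tilde 0_E$ takes the value $0_X$ at every $e\in E$; the universal fuzzy soft set $\tilde 1_E$ takes the value $1_X$ at every $e\in E$. A fuzzy soft topological space with parameter set $E$ is a pair $(X,\tau)$ where $\tau\subseteq FS(X,E)$ contains $\tilde 0_E$ and $\tilde 1_E$, is closed under intersections of two members, and is closed under arbitrary unions. Members of $\tau$ are called fuzzy soft open. A fuzzy soft mapping $(\varphi,\psi):FS(X,E)\to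 FS(Y,K)$ is a pair of functions $\varphi:X\to Y$, $\psi:E\to K$; it is surjective (onto) if both $\varphi$ and $\psi$ are surjective. The inverse image of $(g,B)\in FS(Y,K)$ is the fuzzy soft set $(\varphi,\psi)^{-1}((g,B))\in FS(X,E)$ given by $(\varphi,\psi)^{-1}((g,B))(e)(x)=(g,B)(\psi(e))(\varphi(x))$ for $e\in E$, $x\in X$. The mapping $(\varphi,\psi):(X,\tau)\to(Y,\sigma)$ is fuzzy soft continuous if $(\varphi,\psi)^{-1}((g,B))\in\tau$ for all $(g,B)\in\sigma$. A fuzzy soft open cover of $\tilde 1_E$ is a family $\Psi\subseteq\tau$ such that $\tilde 1_E$ is included in the union of all members of $\Psi$; a subcover is a subfamily of $\Psi$ which is also a cover of $\tilde 1_E$. The space $(X,\tau)$ is compact (fuzzy soft compact) if each fuzzy soft open cover of $\tilde 1_E$ has a finite subcover; likewise for $(Y,\sigma)$ with $\tilde 1_K$. *)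

theory Defs
  imports Complex_Main "HOL-Library.FuncSet"
begin

text \<open>Sets of points and parameters are explicit carriers, so the parameter set may be empty.
  Fuzzy soft sets are extensional functions on these carriers, so equality of functions
  is equality of fuzzy soft sets. The set \<open>A\<close> in \<open>(f,A)\<close> is determined by the mapping
  and is not recorded.\<close>

definition fuzzy_sets :: "'x set \<Rightarrow> ('x \<Rightarrow> real) set" where
  "fuzzy_sets X = X \<rightarrow>\<^sub>E {0..1}"

definition FS :: "'x set \<Rightarrow> 'e set \<Rightarrow> ('e \<Rightarrow> 'x \<Rightarrow> real) set" where
  "FS X E = E \<rightarrow>\<^sub>E fuzzy_sets X"

definition fs_subset ::
    "'x set \<Rightarrow> 'e set \<Rightarrow> ('e \<Rightarrow> 'x \<Rightarrow> real) \<Rightarrow> ('e \<Rightarrow> 'x \<Rightarrow> real) \<Rightarrow> bool" where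
  "fs_subset X E f g \<longleftrightarrow> (\<forall>e\<in>E. \<forall>x\<in>X. f e x \<le> g e x)"

definition fs_null :: "'x set \<Rightarrow> 'e set \<Rightarrow> 'e \<Rightarrow> 'x \<Rightarrow> real" where
  "fs_null X E = (\<lambda>e\<in>E. \<lambda>x\<in>X. 0)"

definition fs_univ :: "'x set \<Rightarrow> 'e set \<Rightarrow> 'e \<Rightarrow> 'x \<Rightarrow> real" where
  "fs_univ X E = (\<lambda>e\<in>E. \<lambda>x\<in>X. 1)"

definition fs_inter ::
    "'x set \<Rightarrow> 'e set \<Rightarrow> ('e \<Rightarrow> 'x \<Rightarrow> real) \<Rightarrow> ('e \<Rightarrow> 'x \<Rightarrow> real) \<Rightarrow> 'e \<Rightarrow> 'x \<Rightarrow> real" where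
  "fs_inter X E f g = (\<lambda>e\<in>E. \<lambda>x\<in>X. min (f e x) (g e x))"

text \<open>Inserting \<open>0\<close> turns the supremum of reals into the supremum in the lattice \<open>[0,1]\<close>:
  it only matters for the empty family, whose union is the null fuzzy soft set.\<close>

definition fs_Union ::
    "'x set \<Rightarrow> 'e set \<Rightarrow> ('e \<Rightarrow> 'x \<Rightarrow> real) set \<Rightarrow> 'e \<Rightarrow> 'x \<Rightarrow> real" where
  "fs_Union X E F = (\<lambda>e\<in>E. \<lambda>x\<in>X. Sup (insert 0 ((\<lambda>f. f e x) ` F)))"

definition fuzzy_soft_topology ::
    "'x set \<Rightarrow> 'e set \<Rightarrow> ('e \<Rightarrow> 'x \<Rightarrow> real) set \<Rightarrow> bool" where
  "fuzzy_soft_topology X E \<tau> \<longleftrightarrow>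
     \<tau> \<subseteq> FS X E \<and>
     fs_null X E \<in> \<tau> \<and> fs_univ X E \<in> \<tau> \<and>
     (\<forall>f\<in>\<tau>. \<forall>g\<in>\<tau>. fs_inter X E f g \<in> \<tau>) \<and>
     (\<forall>F. F \<subseteq> \<tau> \<longrightarrow> fs_Union X E F \<in> \<tau>)"

definition fuzzy_soft_mapping ::
    "'x set \<Rightarrow> 'e set \<Rightarrow> 'y set \<Rightarrow> 'k set \<Rightarrow> ('x \<Rightarrow> 'y) \<Rightarrow> ('e \<Rightarrow> 'k) \<Rightarrow> bool" where
  "fuzzy_soft_mapping X E Y K \<phi> \<psi> \<longleftrightarrow> \<phi> \<in> X \<rightarrow> Y \<and> \<psi> \<in> E \<rightarrow> K"

definition fuzzy_soft_surjective ::
    "'x set \<Rightarrow> 'e set \<Rightarrow> 'y set \<Rightarrow> 'k set \<Rightarrow> ('x \<Rightarrow> 'y) \<Rightarrow> ('e \<Rightarrow> 'k) \<Rightarrow> bool" where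
  "fuzzy_soft_surjective X E Y K \<phi> \<psi> \<longleftrightarrow> \<phi> ` X = Y \<and> \<psi> ` E = K"

definition fs_vimage ::
    "'x set \<Rightarrow> 'e set \<Rightarrow> ('x \<Rightarrow> 'y) \<Rightarrow> ('e \<Rightarrow> 'k) \<Rightarrow> ('k \<Rightarrow> 'y \<Rightarrow> real) \<Rightarrow> 'e \<Rightarrow> 'x \<Rightarrow> real" where
  "fs_vimage X E \<phi> \<psi> g = (\<lambda>e\<in>E. \<lambda>x\<in>X. g (\<psi> e) (\<phi> x))"

definition fuzzy_soft_continuous ::
    "'x set \<Rightarrow> 'e set \<Rightarrow> ('e \<Rightarrow> 'x \<Rightarrow> real) set \<Rightarrow> ('k \<Rightarrow> 'y \<Rightarrow> real) set \<Rightarrow>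
     ('x \<Rightarrow> 'y) \<Rightarrow> ('e \<Rightarrow> 'k) \<Rightarrow> bool" where
  "fuzzy_soft_continuous X E \<tau> \<sigma> \<phi> \<psi> \<longleftrightarrow> (\<forall>g\<in>\<sigma>. fs_vimage X E \<phi> \<psi> g \<in> \<tau>)"

definition fuzzy_soft_open_cover ::
    "'x set \<Rightarrow> 'e set \<Rightarrow> ('e \<Rightarrow> 'x \<Rightarrow> real) set \<Rightarrow> ('e \<Rightarrow> 'x \<Rightarrow> real) set \<Rightarrow> bool" where
  "fuzzy_soft_open_cover X E \<tau> \<Psi> \<longleftrightarrow>
     \<Psi> \<subseteq> \<tau> \<and> fs_subset X E (fs_univ X E) (fs_Union X E \<Psi>)"

definition fuzzy_soft_compact ::
    "'x set \<Rightarrow> 'e set \<Rightarrow> ('e \<Rightarrow> 'x \<Rightarrow> real) set \<Rightarrow> bool" where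
  "fuzzy_soft_compact X E \<tau> \<longleftrightarrow>
     (\<forall>\<Psi>. fuzzy_soft_open_cover X E \<tau> \<Psi> \<longrightarrow>
        (\<exists>\<Phi>\<subseteq>\<Psi>. finite \<Phi> \<and> fuzzy_soft_open_cover X E \<tau> \<Phi>))"

lemma FS_bounds:
  assumes "f \<in> FS X E" "e \<in> E" "x \<in> X"
  shows "0 \<le> f e x" "f e x \<le> 1"
proof -
  have "f e \<in> X \<rightarrow>\<^sub>E {0..1}" using assms(1,2) unfolding FS_def fuzzy_sets_def by blast
  then have "f e x \<in> {0..1}" using assms(3) by blast
  then show "0 \<le> f e x" "f e x \<le> 1" by auto
qed

lemma fs_Union_in_FS:
  assumes "F \<subseteq> FS X E"
  shows "fs_Union X E F \<in> FS X E"
proof -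
  have "Sup (insert 0 ((\<lambda>f. f e x) ` F)) \<in> {0..1}" if "e \<in> E" "x \<in> X" for e x
  proof -
    have le1: "y \<le> 1" if "y \<in> insert 0 ((\<lambda>f. f e x) ` F)" for y
      using that assms FS_bounds(2)[OF _ \<open>e \<in> E\<close> \<open>x \<in> X\<close>] by auto
    then have "bdd_above (insert 0 ((\<lambda>f. f e x) ` F))" by (rule bdd_aboveI)
    then have "0 \<le> Sup (insert 0 ((\<lambda>f. f e x) ` F))" by (intro cSup_upper) auto
    moreover have "Sup (insert 0 ((\<lambda>f. f e x) ` F)) \<le> 1" using le1 by (intro cSup_least) auto
    ultimately show ?thesis by simp
  qed
  then show ?thesis unfolding FS_def fuzzy_sets_def fs_Union_def by auto
qed

lemma fs_Union_upper:
  assumes "F \<subseteq> FS X E" "f \<in> F"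
  shows "fs_subset X E f (fs_Union X E F)"
  unfolding fs_subset_def
proof (intro ballI)
  fix e x assume ex: "e \<in> E" "x \<in> X"
  have "y \<le> 1" if "y \<in> insert 0 ((\<lambda>f. f e x) ` F)" for y
    using that assms(1) FS_bounds(2)[OF _ ex] by auto
  then have "bdd_above (insert 0 ((\<lambda>f. f e x) ` F))" by (rule bdd_aboveI)
  then have "f e x \<le> Sup (insert 0 ((\<lambda>f. f e x) ` F))" using assms(2) by (intro cSup_upper) auto
  then show "f e x \<le> fs_Union X E F e x" using ex by (simp add: fs_Union_def)
qed

lemma fs_Union_least:
  assumes "g \<in> FS X E" "\<And>f. f \<in> F \<Longrightarrow> fs_subset X E f g"
  shows "fs_subset X E (fs_Union X E F) g"
  unfolding fs_subset_def
proof (intro ballI)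
  fix e x assume ex: "e \<in> E" "x \<in> X"
  have "Sup (insert 0 ((\<lambda>f. f e x) ` F)) \<le> g e x"
    using assms(2) ex FS_bounds(1)[OF assms(1) ex]
    by (intro cSup_least) (auto simp: fs_subset_def)
  then show "fs_Union X E F e x \<le> g e x" using ex by (simp add: fs_Union_def)
qed

end

theory Submission
  imports Defs
begin

text \<open>An open cover of the codomain is pulled back to the compact domain, and a finite
  subcover is carried forward again. Inverse images commute with unions
  (\<open>fs_Union_vimage\<close>), and by surjectivity a fuzzy soft set dominates the universal one
  exactly when its inverse image does (\<open>fs_univ_subset_vimage_iff\<close>). With continuity, a
  family of members of \<sigma> covers iff its inverse images form an open cover; both directions of
  this equivalence are used.\<close>

text \<open>At (e, x) both sides are the supremum of 0 and the values of the members of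
  \<open>F\<close> at (\<psi> e, \<phi> x). The mapping hypothesis places that pair in the carriers,
  where \<open>fs_Union Y K F\<close> is given by its formula.\<close>

lemma fs_Union_vimage:
  assumes "fuzzy_soft_mapping X E Y K \<phi> \<psi>"
  shows "fs_Union X E (fs_vimage X E \<phi> \<psi> ` F) = fs_vimage X E \<phi> \<psi> (fs_Union Y K F)"
proof (intro ext)
  fix e x
  show "fs_Union X E (fs_vimage X E \<phi> \<psi> ` F) e x = fs_vimage X E \<phi> \<psi> (fs_Union Y K F) e x"
  proof (cases "e \<in> E \<and> x \<in> X")
    case True
    then have "\<psi> e \<in> K" "\<phi> x \<in> Y"
      using assms by (auto simp: fuzzy_soft_mapping_def)
    then show ?thesis
      using True by (simp add: fs_Union_def fs_vimage_def image_image)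
  next
    \<comment> \<open>Off the carriers both sides have the same default value
      \<open>undefined\<close>, so the equality holds for functions, as rewriting requires.\<close>
    case False
    then show ?thesis
      by (auto simp: fs_Union_def fs_vimage_def restrict_def)
  qed
qed

text \<open>Every pair in K and Y has the form (\<psi> e, \<phi> x), so quantifying over such pairs
  amounts to quantifying over e in E and x in X.\<close>

lemma fs_univ_subset_vimage_iff:
  assumes "fuzzy_soft_surjective X E Y K \<phi> \<psi>"
  shows "fs_subset X E (fs_univ X E) (fs_vimage X E \<phi> \<psi> g) \<longleftrightarrow> fs_subset Y K (fs_univ Y K) g"
proof -
  have "Y = \<phi> ` X" "K = \<psi> ` E"
    using assms by (simp_all add: fuzzy_soft_surjective_def)
  then show ?thesis
    by (simp add: fs_subset_def fs_univ_def fs_vimage_def)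
qed

theorem theorem3p8:
  fixes X :: "'x set" and Y :: "'y set" and E :: "'e set" and K :: "'k set"
    and \<tau> :: "('e \<Rightarrow> 'x \<Rightarrow> real) set" and \<sigma> :: "('k \<Rightarrow> 'y \<Rightarrow> real) set"
    and \<phi> :: "'x \<Rightarrow> 'y" and \<psi> :: "'e \<Rightarrow> 'k"
  assumes "X \<noteq> {}" and "Y \<noteq> {}"
    and "fuzzy_soft_topology X E \<tau>"
    and "fuzzy_soft_topology Y K \<sigma>"
    and "fuzzy_soft_mapping X E Y K \<phi> \<psi>"
    and "fuzzy_soft_continuous X E \<tau> \<sigma> \<phi> \<psi>"
    and "fuzzy_soft_surjective X E Y K \<phi> \<psi>"
    and "fuzzy_soft_compact X E \<tau>"
  shows "fuzzy_soft_compact Y K \<sigma>"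
proof -
  let ?v = "fs_vimage X E \<phi> \<psi>"
  have cover_iff: "fuzzy_soft_open_cover X E \<tau> (?v ` \<Phi>) \<longleftrightarrow> fuzzy_soft_open_cover Y K \<sigma> \<Phi>"
    if "\<Phi> \<subseteq> \<sigma>" for \<Phi>
  proof -
    have "?v ` \<Phi> \<subseteq> \<tau>"
      using that assms(6) unfolding fuzzy_soft_continuous_def by blast
    with that show ?thesis
      unfolding fuzzy_soft_open_cover_def fs_Union_vimage[OF assms(5)]
        fs_univ_subset_vimage_iff[OF assms(7)] by simp
  qed
  show ?thesis
    unfolding fuzzy_soft_compact_def
  proof (intro allI impI)
    fix \<Psi> assume \<Psi>: "fuzzy_soft_open_cover Y K \<sigma> \<Psi>"
    then have sub: "\<Psi> \<subseteq> \<sigma>"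
      by (simp add: fuzzy_soft_open_cover_def)
    then have "fuzzy_soft_open_cover X E \<tau> (?v ` \<Psi>)"
      using \<Psi> cover_iff by blast
    then obtain \<Theta> where \<Theta>: "\<Theta> \<subseteq> ?v ` \<Psi>" "finite \<Theta>" "fuzzy_soft_open_cover X E \<tau> \<Theta>"
      using assms(8) unfolding fuzzy_soft_compact_def by blast
    \<comment> \<open>Choosing one member of \<Psi> for each of the finitely many inverse images in
      \<Theta> keeps the family finite.\<close>
    obtain \<Phi> where \<Phi>: "\<Phi> \<subseteq> \<Psi>" "finite \<Phi>" "\<Theta> = ?v ` \<Phi>"
      using finite_subset_image[OF \<Theta>(2,1)] by blast
    have "fuzzy_soft_open_cover Y K \<sigma> \<Phi>"
      using \<Theta>(3) cover_iff[of \<Phi>] \<Phi>(1) sub unfolding \<Phi>(3) by simp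
    with \<Phi>(1,2) show "\<exists>\<Phi>\<subseteq>\<Psi>. finite \<Phi> \<and> fuzzy_soft_open_cover Y K \<sigma> \<Phi>"
      by blast
  qed
qed

end
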